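(* Let $\mathcal{G}$ be a graph with Euclidean edges, let $Z_{\mathcal{G}}$ be the associated auxiliary Gaussian random field on $\mathcal{G}$, and let $d_R(u,v)=\mathrm{var}(Z_{\mathcal{G}}(u)-Z_{\mathcal{G}}(v))$ be the resistance metric on $\mathcal{G}$. Let $f$ be a real-valued square-integrable function on $\mathbb{R}$, let $\epsilon$ be a random weight with $\mathbb{P}(\epsilon=1)=\mathbb{P}(\epsilon=-1)=1/2$, and let $X$ be a real random variable with a probability density function $\varpi$ that is positive on $\mathbb{R}$, where $Z_{\mathcal{G}}(\cdot)$, $\epsilon$ and $X$ are mutually independent. Define the random field $$Y(u) := \frac{\epsilon\, f\big(Z_{\mathcal{G}}(u)-X\big)}{\sqrt{\varpi(X)}},\qquad u\in\mathcal{G}.$$ Then $Y$ has zero mean and is isotropic with respect to the resistance metric, i.e. $\mathrm{cov}(Y(u),Y(v))=C_Y(d_R(u,v))$ for all $u,v\in\mathcal{G}$, where $$C_Y(d_R(u,v)) = \frac{1}{\sqrt{2\pi}}\int_{\mathbb{R}}\psi_f\left(\sqrt{d_R(u,v)}\,z\right)\exp(-z^2/2)\,\mathrm{d}z$$ and $\psi_f(h)=\int_{\mathbb{R}}f(x+h)f(x)\,\mathrm{d}x$, $h\in\mathbb{R}$, is the transitive covariogram of $f$.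
   Context: Graph with Euclidean edges: a triple $\mathcal{G}=(\mathcal{V},\mathcal{E},\{\varphi_e\}_{e\in\mathcal{E}})$ such that: (a) $(\mathcal{V},\mathcal{E})$ is a finite, simple (no repeated edges, no loops), connected graph with vertex set $\mathcal{V}$ and edge set $\mathcal{E}$; (b) each edge $e\in\mathcal{E}$ is associated with an abstract set, also denoted $e$, such that $\mathcal{V}$ and all the edge sets are mutually disjoint; (c) if $e$ joins the vertices $u,v$, then $\varphi_e$ is a bijection defined on $e\cup\{u,v\}$ that maps $e$ onto an open interval $(\underline{e},\overline{e})\subset\mathbb{R}$ and $\{u,v\}$ onto $\{\underline{e},\overline{e}\}$. Writing $u\in\mathcal{G}$ means $u\in\mathcal{V}\cup\bigcup_{e\in\mathcal{E}}e$. For $u\in e$, $\underline{u}$ and $\overline{u}$ denote the vertices joined by $e$ corresponding under $\varphi_e$ to $\underline{e}$ and $\overline{e}$; for $u\in\mathcal{V}$, $\underline{u}=\overline{u}=u$. Two vertices are neighbors if some edge joins them. Auxiliary field: $Z_{\mathcal{G}}(u)=Z_\mu(u)+\sum_{e\in\mathcal{E}}Z_e(u)$, $u\in\mathcal{G}$, where: (i) on the vertices $v_1,\dots,v_n$ of $\mathcal{G}$, $(Z_\mu(v_1),\dots,Z_\mu(v_n))^\top\sim\mathcal{N}(0,L^{-1})$. Here, for $u,v\in\mathcal{V}$, $c(u,v)=1/d_G(u,v)$ if $u,v$ are neighbors, with $d_G(u,v)$ the length $\overline{e}-\underline{e}$ of the edge $e$ joining them, and $c(u,v)=0$ otherwise;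 $c(u)=\sum_{v}c(u,v)$; $u_0\in\mathcal{V}$ is an arbitrary fixed vertex; and $L(u,v)=1+c(u_0)$ if $u=v=u_0$, $L(u,v)=c(u)$ if $u=v\neq u_0$, and $L(u,v)=-c(u,v)$ if $u\ne v$ ($L$ is strictly positive definite); (ii) $Z_\mu$ is extended to the edges by $Z_\mu(u)=(1-d(u))Z_\mu(\underline{u})+d(u)Z_\mu(\overline{u})$, where, for $u\in e$, $d(u)=(\varphi_e(u)-\underline{e})/(\overline{e}-\underline{e})$, and $d(u)=0$ for $u\in\mathcal{V}$; (iii) $Z_e(u)=B_e(\varphi_e(u))$ for $u\in e$ and $Z_e(u)=0$ otherwise, where the $B_e$, $e\in\mathcal{E}$, are mutually independent standard Brownian bridges on $[\underline{e},\overline{e}]$ with $B_e(\underline{e})=B_e(\overline{e})=0$ (centered Gaussian with covariance $(\min(s,t)-\underline{e})(\overline{e}-\max(s,t))/(\overline{e}-\underline{e})$), independent of $Z_\mu$. Isotropic with respect to $d_R$ means that the covariance function depends on $(u,v)$ only through $d_R(u,v)$. *)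

theory Defs
  imports "HOL-Probability.Probability"
begin

section \<open>Graphs with Euclidean edges\<close>

text \<open>
  Edges are unordered pairs of vertices, so that simplicity is built into the encoding.
  The abstract set attached to the edge \<open>e\<close> is \<open>edge_pts G e\<close>, the bijection \<open>\<phi>\<^sub>e\<close> is
  \<open>chart G e\<close>, restricted to \<open>edge_pts G e \<union> e\<close>, and its open interval is
  \<open>{lower_end G e<..<upper_end G e}\<close>.
\<close>

record 'a euclidean_graph =
  verts :: "'a set"
  edges :: "'a set set"
  edge_pts :: "'a set \<Rightarrow> 'a set"
  chart :: "'a set \<Rightarrow> 'a \<Rightarrow> real"
  lower_end :: "'a set \<Rightarrow> real"
  upper_end :: "'a set \<Rightarrow> real"

definition neighbors :: "'a euclidean_graph \<Rightarrow> 'a \<Rightarrow> 'a \<Rightarrow> bool" where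
  "neighbors G u v \<longleftrightarrow> {u, v} \<in> edges G"

definition finite_simple_connected :: "'a euclidean_graph \<Rightarrow> bool" where
  "finite_simple_connected G \<longleftrightarrow>
     finite (verts G) \<and> verts G \<noteq> {} \<and>
     (\<forall>e\<in>edges G. e \<subseteq> verts G \<and> card e = 2) \<and>
     (\<forall>u\<in>verts G. \<forall>v\<in>verts G. (neighbors G)\<^sup>*\<^sup>* u v)"

definition graph_with_euclidean_edges :: "'a euclidean_graph \<Rightarrow> bool" where
  "graph_with_euclidean_edges G \<longleftrightarrow>
     finite_simple_connected G \<and>
     (\<forall>e\<in>edges G. verts G \<inter> edge_pts G e = {}) \<and>
     (\<forall>e\<in>edges G. \<forall>e'\<in>edges G. e \<noteq> e' \<longrightarrow> edge_pts G e \<inter> edge_pts G e' = {}) \<and>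
     (\<forall>e\<in>edges G. lower_end G e < upper_end G e \<and>
        inj_on (chart G e) (edge_pts G e \<union> e) \<and>
        chart G e ` edge_pts G e = {lower_end G e<..<upper_end G e} \<and>
        chart G e ` e = {lower_end G e, upper_end G e})"

definition points :: "'a euclidean_graph \<Rightarrow> 'a set" where
  "points G = verts G \<union> (\<Union>e\<in>edges G. edge_pts G e)"

definition host_edge :: "'a euclidean_graph \<Rightarrow> 'a \<Rightarrow> 'a set" where
  "host_edge G u = (THE e. e \<in> edges G \<and> u \<in> edge_pts G e)"

definition lower_vert :: "'a euclidean_graph \<Rightarrow> 'a \<Rightarrow> 'a" where
  "lower_vert G u = (if u \<in> verts G then u
     else THE w. w \<in> host_edge G u \<and> chart G (host_edge G u) w = lower_end G (host_edge G u))"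

definition upper_vert :: "'a euclidean_graph \<Rightarrow> 'a \<Rightarrow> 'a" where
  "upper_vert G u = (if u \<in> verts G then u
     else THE w. w \<in> host_edge G u \<and> chart G (host_edge G u) w = upper_end G (host_edge G u))"

definition edge_length :: "'a euclidean_graph \<Rightarrow> 'a set \<Rightarrow> real" where
  "edge_length G e = upper_end G e - lower_end G e"

definition rel_pos :: "'a euclidean_graph \<Rightarrow> 'a \<Rightarrow> real" where
  "rel_pos G u = (if u \<in> verts G then 0
     else (chart G (host_edge G u) u - lower_end G (host_edge G u)) / edge_length G (host_edge G u))"

section \<open>The precision matrix of the vertex field\<close>

definition conductance :: "'a euclidean_graph \<Rightarrow> 'a \<Rightarrow> 'a \<Rightarrow> real" where
  "conductance G u v = (if neighbors G u v then 1 / edge_length G {u, v} else 0)"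

definition total_conductance :: "'a euclidean_graph \<Rightarrow> 'a \<Rightarrow> real" where
  "total_conductance G u = (\<Sum>v\<in>verts G. conductance G u v)"

definition precision_matrix :: "'a euclidean_graph \<Rightarrow> 'a \<Rightarrow> 'a \<Rightarrow> 'a \<Rightarrow> real" where
  "precision_matrix G u0 u v =
     (if u = v then (if u = u0 then 1 + total_conductance G u0 else total_conductance G u)
      else - conductance G u v)"

text \<open>
  Matrices here are indexed by a finite set rather than a type; the inverse is defined
  as \<open>matrix_inv\<close> is, and its entries outside \<open>I \<times> I\<close> are irrelevant.
\<close>

definition matrix_inv_on :: "'a set \<Rightarrow> ('a \<Rightarrow> 'a \<Rightarrow> real) \<Rightarrow> 'a \<Rightarrow> 'a \<Rightarrow> real" where
  "matrix_inv_on I A = (SOME A'.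
     \<forall>u\<in>I. \<forall>v\<in>I. (\<Sum>w\<in>I. A u w * A' w v) = of_bool (u = v) \<and>
                   (\<Sum>w\<in>I. A' u w * A w v) = of_bool (u = v))"

section \<open>Gaussian fields and independence\<close>

definition covariance :: "'w measure \<Rightarrow> ('w \<Rightarrow> real) \<Rightarrow> ('w \<Rightarrow> real) \<Rightarrow> real" where
  "covariance M X Y =
     integral\<^sup>L M (\<lambda>\<omega>. (X \<omega> - integral\<^sup>L M X) * (Y \<omega> - integral\<^sup>L M Y))"

text \<open>The degenerate normal law, of variance 0, is a point mass.\<close>

definition normal_law :: "real \<Rightarrow> real \<Rightarrow> real measure" where
  "normal_law m \<sigma> = (if \<sigma> = 0 then return borel m
     else density lborel (\<lambda>x. ennreal (normal_density m \<sigma> x)))"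

definition gaussian_field :: "'w measure \<Rightarrow> 'i set \<Rightarrow> ('i \<Rightarrow> 'w \<Rightarrow> real) \<Rightarrow> bool" where
  "gaussian_field M T X \<longleftrightarrow>
     (\<forall>t\<in>T. X t \<in> borel_measurable M) \<and>
     (\<forall>F a. finite F \<and> F \<subseteq> T \<longrightarrow>
        (\<exists>m \<sigma>. 0 \<le> \<sigma> \<and> distr M borel (\<lambda>\<omega>. \<Sum>t\<in>F. a t * X t \<omega>) = normal_law m \<sigma>))"

definition centered_gaussian_field ::
  "'w measure \<Rightarrow> 'i set \<Rightarrow> ('i \<Rightarrow> 'w \<Rightarrow> real) \<Rightarrow> ('i \<Rightarrow> 'i \<Rightarrow> real) \<Rightarrow> bool" where
  "centered_gaussian_field M T X K \<longleftrightarrow>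
     gaussian_field M T X \<and>
     (\<forall>t\<in>T. integral\<^sup>L M (X t) = 0) \<and>
     (\<forall>s\<in>T. \<forall>t\<in>T. covariance M (X s) (X t) = K s t)"

definition brownian_bridge :: "'w measure \<Rightarrow> real \<Rightarrow> real \<Rightarrow> (real \<Rightarrow> 'w \<Rightarrow> real) \<Rightarrow> bool" where
  "brownian_bridge M a b B \<longleftrightarrow>
     (AE \<omega> in M. B a \<omega> = 0 \<and> B b \<omega> = 0) \<and>
     centered_gaussian_field M {a..b} B (\<lambda>s t. (min s t - a) * (b - max s t) / (b - a))"

text \<open>
  Independence of random fields with different index types is independence of the
  \<open>\<sigma>\<close>-algebras they generate; \<open>indep_vars\<close> would force a common value type.
\<close>

definition generated_events :: "'w measure \<Rightarrow> 'i set \<Rightarrow> ('i \<Rightarrow> 'w \<Rightarrow> real) \<Rightarrow> 'w set set" where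
  "generated_events M T X =
     sigma_sets (space M) {X t -` A \<inter> space M | t A. t \<in> T \<and> A \<in> sets borel}"

definition generated_events_rv :: "'w measure \<Rightarrow> ('w \<Rightarrow> real) \<Rightarrow> 'w set set" where
  "generated_events_rv M X = generated_events M {()} (\<lambda>_. X)"

definition mutually_indep3 :: "'w measure \<Rightarrow> 'w set set \<Rightarrow> 'w set set \<Rightarrow> 'w set set \<Rightarrow> bool" where
  "mutually_indep3 M A B C \<longleftrightarrow> prob_space.indep_sets M (\<lambda>i. [A, B, C] ! i) {..<3::nat}"

section \<open>The auxiliary field and the resistance metric\<close>

definition vertex_extension ::
  "'a euclidean_graph \<Rightarrow> ('a \<Rightarrow> 'w \<Rightarrow> real) \<Rightarrow> 'a \<Rightarrow> 'w \<Rightarrow> real" where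
  "vertex_extension G W u \<omega> =
     (1 - rel_pos G u) * W (lower_vert G u) \<omega> + rel_pos G u * W (upper_vert G u) \<omega>"

definition edge_field ::
  "'a euclidean_graph \<Rightarrow> ('a set \<Rightarrow> real \<Rightarrow> 'w \<Rightarrow> real) \<Rightarrow> 'a set \<Rightarrow> 'a \<Rightarrow> 'w \<Rightarrow> real" where
  "edge_field G B e u \<omega> = (if u \<in> edge_pts G e then B e (chart G e u) \<omega> else 0)"

definition auxiliary_field ::
  "'w measure \<Rightarrow> 'a euclidean_graph \<Rightarrow> 'a \<Rightarrow> ('a \<Rightarrow> 'w \<Rightarrow> real) \<Rightarrow> bool" where
  "auxiliary_field M G u0 Z \<longleftrightarrow> (\<exists>W B.
     centered_gaussian_field M (verts G) W (matrix_inv_on (verts G) (precision_matrix G u0)) \<and>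
     (\<forall>e\<in>edges G. brownian_bridge M (lower_end G e) (upper_end G e) (B e)) \<and>
     prob_space.indep_sets M
       (\<lambda>e. generated_events M {lower_end G e..upper_end G e} (B e)) (edges G) \<and>
     prob_space.indep_set M
       (generated_events M (verts G) W)
       (generated_events M (SIGMA e:edges G. {lower_end G e..upper_end G e}) (\<lambda>(e, t). B e t)) \<and>
     (\<forall>u\<in>points G. \<forall>\<omega>\<in>space M.
        Z u \<omega> = vertex_extension G W u \<omega> + (\<Sum>e\<in>edges G. edge_field G B e u \<omega>)))"

definition resistance_metric :: "'w measure \<Rightarrow> ('a \<Rightarrow> 'w \<Rightarrow> real) \<Rightarrow> 'a \<Rightarrow> 'a \<Rightarrow> real" where
  "resistance_metric M Z u v = prob_space.variance M (\<lambda>\<omega>. Z u \<omega> - Z v \<omega>)"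

section \<open>The field Y and its covariance\<close>

definition dilution_field ::
  "(real \<Rightarrow> real) \<Rightarrow> (real \<Rightarrow> real) \<Rightarrow> ('w \<Rightarrow> real) \<Rightarrow> ('w \<Rightarrow> real) \<Rightarrow> ('a \<Rightarrow> 'w \<Rightarrow> real)
     \<Rightarrow> 'a \<Rightarrow> 'w \<Rightarrow> real" where
  "dilution_field f p \<epsilon> X Z u \<omega> = \<epsilon> \<omega> * f (Z u \<omega> - X \<omega>) / sqrt (p (X \<omega>))"

definition transitive_covariogram :: "(real \<Rightarrow> real) \<Rightarrow> real \<Rightarrow> real" where
  "transitive_covariogram f h = (LINT x|lborel. f (x + h) * f x)"

definition C_Y :: "(real \<Rightarrow> real) \<Rightarrow> real \<Rightarrow> real" where
  "C_Y f d = 1 / sqrt (2 * pi) *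
     (LINT z|lborel. transitive_covariogram f (sqrt d * z) * exp (- z\<^sup>2 / 2))"

definition isotropic_wrt :: "'a set \<Rightarrow> ('a \<Rightarrow> 'a \<Rightarrow> real) \<Rightarrow> ('a \<Rightarrow> 'a \<Rightarrow> real) \<Rightarrow> bool" where
  "isotropic_wrt S d K \<longleftrightarrow> (\<exists>C :: real \<Rightarrow> real. \<forall>u\<in>S. \<forall>v\<in>S. K u v = C (d u v))"

end

theory Submission
  imports Defs
begin

text \<open>
  The increment \<open>Z u - Z v\<close> is a sum of independent centred normal variables, namely a linear
  combination of the vertex values and one of each Brownian bridge, hence \<open>N(0, d\<^sub>R(u, v))\<close>; the
  precision matrix plays no further role. Since \<open>\<epsilon>\<close> is centred and independent of \<open>(Z, X)\<close>, the field
  \<open>Y\<close> is centred, and since \<open>\<epsilon>\<^sup>2 = 1\<close>, its covariance is the expectation of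
  \<open>f(Z u - X) f(Z v - X) / \<pi>X X\<close>. Integrating out \<open>X\<close> cancels the density, so by translation and
  reflection invariance of Lebesgue measure there remains the expectation of \<open>\<psi>\<^sub>f(Z u - Z v)\<close>.
\<close>

section \<open>Normal laws\<close>

text \<open>Writing every normal law as an affine image of one standard normal variable absorbs the
  point mass at \<sigma> = 0, so the two branches of \<open>normal_law\<close> are separated only
  here.\<close>

lemma normal_law_eq_distr:
  assumes "0 \<le> \<sigma>"
  shows "normal_law m \<sigma> = distr std_normal_distribution borel (\<lambda>z. m + \<sigma> * z)"
proof -
  interpret N: prob_space std_normal_distribution
    by (simp add: prob_space_normal_density)
  show ?thesis
  proof (cases "\<sigma> = 0")
    case True
    then show ?thesis
      by (simp add: normal_law_def N.distr_const)
  next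
    case False
    with assms have \<sigma>: "0 < \<sigma>" by simp
    \<comment> \<open>The identity is a standard normal variable on the space carrying the standard
      normal law, so its affine image has the density wanted.\<close>
    have "distributed std_normal_distribution lborel (\<lambda>x. x) std_normal_density"
      by (simp add: distributed_def distr_id2)
    from N.normal_density_affine[OF this, of \<sigma> m] \<sigma>
    have "distr std_normal_distribution lborel (\<lambda>z. m + \<sigma> * z) = density lborel (normal_density m \<sigma>)"
      by (simp add: distributed_distr_eq_density)
    moreover have "distr std_normal_distribution lborel (\<lambda>z. m + \<sigma> * z) =
        distr std_normal_distribution borel (\<lambda>z. m + \<sigma> * z)"
      by (rule distr_cong) simp_all
    ultimately show ?thesis
      using False by (simp add: normal_law_def)
  qed
qed

lemma real_distribution_normal_law:
  assumes "0 \<le> \<sigma>"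
  shows "real_distribution (normal_law m \<sigma>)"
  unfolding normal_law_eq_distr[OF assms]
  by (rule prob_space.real_distribution_distr) (simp_all add: prob_space_normal_density)

lemma char_normal_law:
  assumes "0 \<le> \<sigma>"
  shows "char (normal_law m \<sigma>) t = iexp (m * t) * exp (- (\<sigma>\<^sup>2 * t\<^sup>2) / 2)"
proof -
  have "char (normal_law m \<sigma>) t = (CLINT z|std_normal_distribution. iexp (t * (m + \<sigma> * z)))"
    by (simp add: char_def normal_law_eq_distr[OF assms] integral_distr)
  also have "\<dots> = (CLINT z|std_normal_distribution. iexp (m * t) * iexp ((\<sigma> * t) * z))"
    by (intro Bochner_Integration.integral_cong) (simp_all add: exp_add[symmetric] algebra_simps)
  also have "\<dots> = iexp (m * t) * char std_normal_distribution (\<sigma> * t)"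
    by (simp add: char_def)
  finally show ?thesis
    by (simp add: char_std_normal_distribution power_mult_distrib)
qed

text \<open>By Levy uniqueness it suffices to compare characteristic functions: independence turns
  the sum into a product, and the exponents of the Gaussian factors add.\<close>

lemma (in prob_space) distr_sum_normal_law:
  fixes X :: "'i \<Rightarrow> 'a \<Rightarrow> real"
  assumes indep: "indep_vars (\<lambda>_. borel) X I"
    and pos: "\<And>i. i \<in> I \<Longrightarrow> 0 \<le> \<sigma> i"
    and law: "\<And>i. i \<in> I \<Longrightarrow> distr M borel (X i) = normal_law (m i) (\<sigma> i)"
  shows "distr M borel (\<lambda>\<omega>. \<Sum>i\<in>I. X i \<omega>) =
    normal_law (\<Sum>i\<in>I. m i) (sqrt (\<Sum>i\<in>I. (\<sigma> i)\<^sup>2))"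
proof (rule Levy_uniqueness)
  have [measurable]: "X i \<in> borel_measurable M" if "i \<in> I" for i
    using indep that by (auto simp: indep_vars_def)
  show "real_distribution (distr M borel (\<lambda>\<omega>. \<Sum>i\<in>I. X i \<omega>))"
    by (rule real_distribution_distr) simp
  show "real_distribution (normal_law (\<Sum>i\<in>I. m i) (sqrt (\<Sum>i\<in>I. (\<sigma> i)\<^sup>2)))"
    by (rule real_distribution_normal_law) (simp add: sum_nonneg)
  show "char (distr M borel (\<lambda>\<omega>. \<Sum>i\<in>I. X i \<omega>)) =
      char (normal_law (\<Sum>i\<in>I. m i) (sqrt (\<Sum>i\<in>I. (\<sigma> i)\<^sup>2)))"
  proof
    fix t
    have "char (distr M borel (\<lambda>\<omega>. \<Sum>i\<in>I. X i \<omega>)) t =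
        (\<Prod>i\<in>I. iexp (m i * t) * exp (- ((\<sigma> i)\<^sup>2 * t\<^sup>2) / 2))"
      unfolding char_distr_sum[OF indep]
      by (rule prod.cong) (simp_all add: law char_normal_law pos)
    also have "\<dots> = iexp ((\<Sum>i\<in>I. m i) * t) * exp (- ((\<Sum>i\<in>I. (\<sigma> i)\<^sup>2) * t\<^sup>2) / 2)"
    \<comment> \<open>For infinite \<open>I\<close> both sides are 1, since the product is 1 and the
      sums are 0 by convention.\<close>
    proof (cases "finite I")
      case True
      then show ?thesis
        by (induction I rule: finite_induct)
          (simp_all add: exp_add[symmetric] algebra_simps add_divide_distrib diff_divide_distrib exp_of_real[symmetric])
    qed simp
    also have "\<dots> = char (normal_law (\<Sum>i\<in>I. m i) (sqrt (\<Sum>i\<in>I. (\<sigma> i)\<^sup>2))) t"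
      by (simp add: char_normal_law sum_nonneg)
    finally show "char (distr M borel (\<lambda>\<omega>. \<Sum>i\<in>I. X i \<omega>)) t =
        char (normal_law (\<Sum>i\<in>I. m i) (sqrt (\<Sum>i\<in>I. (\<sigma> i)\<^sup>2))) t" .
  qed
qed

text \<open>The case of a family of two summands, indexed by \<open>bool\<close> because
  \<open>indep_var\<close> is defined through \<open>case_bool\<close>.\<close>

lemma (in prob_space) distr_add_normal_law:
  fixes X Y :: "'a \<Rightarrow> real"
  assumes indep: "indep_var borel X borel Y"
    and pos: "0 \<le> \<sigma>" "0 \<le> \<tau>"
    and law: "distr M borel X = normal_law m \<sigma>" "distr M borel Y = normal_law n \<tau>"
  shows "distr M borel (\<lambda>\<omega>. X \<omega> + Y \<omega>) = normal_law (m + n) (sqrt (\<sigma>\<^sup>2 + \<tau>\<^sup>2))"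
proof -
  have "(\<lambda>_. borel) = case_bool borel borel"
    by (auto split: bool.split)
  with indep have "indep_vars (\<lambda>_. borel) (case_bool X Y) UNIV"
    unfolding indep_var_def by metis
  moreover have "0 \<le> case_bool \<sigma> \<tau> i"
    "distr M borel (case_bool X Y i) = normal_law (case_bool m n i) (case_bool \<sigma> \<tau> i)" for i
    using pos law by (auto split: bool.split)
  ultimately show ?thesis
    using distr_sum_normal_law[of "case_bool X Y" UNIV "case_bool \<sigma> \<tau>" "case_bool m n"]
    by (simp add: UNIV_bool add_ac)
qed

text \<open>\<open>D\<close> has the same law as \<open>m + \<sigma> * z\<close> for a standard
  normal \<open>z\<close>, so everything reduces to the moments 0 and 1 of \<open>z\<close> and of
  its square.\<close>

lemma
  assumes pos: "0 \<le> \<sigma>" and law: "distr M borel D = normal_law m \<sigma>"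
    and D [measurable]: "D \<in> borel_measurable M"
  shows integrable_normal_law: "integrable M D"
    and integral_normal_law: "integral\<^sup>L M D = m"
    and variance_normal_law: "integral\<^sup>L M (\<lambda>\<omega>. (D \<omega> - m)\<^sup>2) = \<sigma>\<^sup>2"
proof -
  define N where "N = std_normal_distribution"
  interpret N: prob_space N
    unfolding N_def by (simp add: prob_space_normal_density)
  have [measurable_cong]: "sets N = sets borel"
    by (simp add: N_def)
  have law': "distr M borel D = distr N borel (\<lambda>z. m + \<sigma> * z)"
    using law normal_law_eq_distr[OF pos] by (simp add: N_def)
  have 1: "integrable N (\<lambda>z. z)" "integral\<^sup>L N (\<lambda>z. z) = 0" "integral\<^sup>L N (\<lambda>z. z\<^sup>2) = 1"
    using integrable_std_normal_distribution_moment[of 1, folded N_def]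
      integral_std_normal_distribution_moment_odd[of 1, folded N_def]
      std_normal_distribution_even_moments(1)[of 1, folded N_def]
    by (simp_all add: fact_2)
  \<comment> \<open>The transfer is stated for arbitrary measurable \<open>g\<close> because it
    serves both the identity and the squared deviation from \<open>m\<close>.\<close>
  have iff: "integrable M (\<lambda>\<omega>. g (D \<omega>)) \<longleftrightarrow> integrable N (\<lambda>z. g (m + \<sigma> * z))"
    and eq: "integral\<^sup>L M (\<lambda>\<omega>. g (D \<omega>)) = integral\<^sup>L N (\<lambda>z. g (m + \<sigma> * z))"
    if [measurable]: "g \<in> borel_measurable borel" for g :: "real \<Rightarrow> real"
    using integrable_distr_eq[OF D that] integral_distr[OF D that]
      integrable_distr_eq[of "\<lambda>z. m + \<sigma> * z" N borel g] integral_distr[of "\<lambda>z. m + \<sigma> * z" N borel g]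
    by (simp_all add: law')
  have "integrable N (\<lambda>z. m + \<sigma> * z)"
    by (intro Bochner_Integration.integrable_add integrable_mult_right 1 N.integrable_const)
  then show "integrable M D"
    by (rule iff[THEN iffD2, rotated]) simp
  have "integral\<^sup>L N (\<lambda>z. m + \<sigma> * z) = m"
    using 1 by (subst Bochner_Integration.integral_add) (auto simp: N.prob_space)
  then show "integral\<^sup>L M D = m"
    by (rule eq[THEN trans, rotated]) simp
  have "integral\<^sup>L N (\<lambda>z. (m + \<sigma> * z - m)\<^sup>2) = \<sigma>\<^sup>2"
    using 1(3) by (simp add: power_mult_distrib)
  then show "integral\<^sup>L M (\<lambda>\<omega>. (D \<omega> - m)\<^sup>2) = \<sigma>\<^sup>2"
    by (rule eq[THEN trans, rotated]) simp
qed

section \<open>Independence\<close>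

text \<open>\<open>sigma\<close> adds nothing to a \<sigma>-algebra. Hence a mere collection of
  events, such as \<open>generated_events\<close>, can be treated as a measurable space below
  \<open>M\<close>.\<close>

lemma subalgebra_sigma:
  assumes "sigma_algebra (space M) \<A>" "\<A> \<subseteq> sets M"
  shows "subalgebra M (sigma (space M) \<A>)"
proof -
  interpret sigma_algebra "space M" \<A> by fact
  show ?thesis
    using assms(2) by (simp add: subalgebra_def space_measure_of_conv)
qed

text \<open>Preimages under \<open>X i\<close> stay inside the \<sigma>-algebra of index
  \<open>i\<close>, so independence is inherited. This is how independence of whole fields passes to
  linear combinations of their values.\<close>

lemma (in prob_space) indep_vars_if_indep_sets:
  assumes indep: "indep_sets \<A> I"
    and alg: "\<And>i. i \<in> I \<Longrightarrow> sigma_algebra (space M) (\<A> i)"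
    and X: "\<And>i. i \<in> I \<Longrightarrow> X i \<in> measurable (sigma (space M) (\<A> i)) (S i)"
  shows "indep_vars S X I"
  unfolding indep_vars_def
proof (intro conjI ballI)
  have X': "X i -` U \<inter> space M \<in> \<A> i" if "i \<in> I" "U \<in> sets (S i)" for i U
  proof -
    interpret sigma_algebra "space M" "\<A> i" by (rule alg) fact
    show ?thesis
      using measurable_sets[OF X[OF that(1)] that(2)] by simp
  qed
  show "X i \<in> measurable M (S i)" if "i \<in> I" for i
    using indep that
    by (intro measurable_from_subalg[OF subalgebra_sigma[OF alg] X]) (auto simp: indep_sets_def)
  show "indep_sets (\<lambda>i. sigma_sets (space M) {X i -` A \<inter> space M |A. A \<in> sets (S i)}) I"
    using X' by (intro indep_sets_mono_sets[OF indep] sigma_algebra.sigma_sets_subset[OF alg]) auto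
qed

lemma (in prob_space) indep_var_if_indep_set:
  assumes indep: "indep_set \<A> \<B>"
    and alg: "sigma_algebra (space M) \<A>" "sigma_algebra (space M) \<B>"
    and X: "X \<in> measurable (sigma (space M) \<A>) S" and Y: "Y \<in> measurable (sigma (space M) \<B>) T"
  shows "indep_var S X T Y"
  unfolding indep_var_def
  by (rule indep_vars_if_indep_sets[OF indep[unfolded indep_set_def]])
    (use alg X Y in \<open>auto split: bool.split\<close>)

text \<open>Independent families closed under intersection may be grouped: disjoint blocks of
  indices generate independent \<sigma>-algebras. The two blocks are indexed by \<open>bool\<close>,
  as in \<open>indep_set\<close>.\<close>

lemma (in prob_space) indep_set_collect_sigma:
  assumes indep: "indep_sets E I" and sub: "A \<subseteq> I" "B \<subseteq> I" "A \<inter> B = {}"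
    and stable: "\<And>i. i \<in> I \<Longrightarrow> Int_stable (E i)"
  shows "indep_set (sigma_sets (space M) (\<Union>i\<in>A. E i)) (sigma_sets (space M) (\<Union>i\<in>B. E i))"
proof -
  have "indep_sets (\<lambda>j. sigma_sets (space M) (\<Union>i\<in>case_bool A B j. E i)) UNIV"
    using sub
    by (intro indep_sets_collect_sigma indep_sets_mono_index[OF _ indep] stable)
      (auto simp: disjoint_family_on_def split: bool.splits)
  then show ?thesis
    unfolding indep_set_def by (rule indep_sets_mono_sets) (auto split: bool.split)
qed

lemma generators_subset_Pow:
  "{X t -` A \<inter> space M | t A. t \<in> T \<and> A \<in> sets borel} \<subseteq> Pow (space M)"
  by auto

lemma sigma_algebra_generated_events: "sigma_algebra (space M) (generated_events M T X)"
  unfolding generated_events_def by (rule sigma_algebra_sigma_sets[OF generators_subset_Pow])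

lemma Int_stable_generated_events: "Int_stable (generated_events M T X)"
proof -
  interpret sigma_algebra "space M" "generated_events M T X"
    by (rule sigma_algebra_generated_events)
  show ?thesis
    by (auto simp: Int_stable_def)
qed

lemma measurable_generated_events:
  assumes "t \<in> T"
  shows "X t \<in> borel_measurable (sigma (space M) (generated_events M T X))"
proof (rule measurableI)
  fix A :: "real set" assume "A \<in> sets borel"
  then show "X t -` A \<inter> space (sigma (space M) (generated_events M T X)) \<in>
      sets (sigma (space M) (generated_events M T X))"
    using assms sigma_algebra.sets_measure_of_eq[OF sigma_algebra_generated_events, of M T X]
    by (auto simp: space_measure_of_conv generated_events_def)
qed simp

text \<open>A product of \<sigma>-finite measures is determined by its values on rectangles, and
  there independence factors the probability. \<open>X\<close> and \<open>Y\<close> may have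
  different value types, which is needed for a pair of field values against a single real.\<close>

lemma (in prob_space) distr_Pair_if_indep_set:
  assumes indep: "indep_set \<A> \<B>"
    and alg: "sigma_algebra (space M) \<A>" "sigma_algebra (space M) \<B>"
    and X: "X \<in> measurable (sigma (space M) \<A>) S" and Y: "Y \<in> measurable (sigma (space M) \<B>) T"
  shows "distr M (S \<Otimes>\<^sub>M T) (\<lambda>\<omega>. (X \<omega>, Y \<omega>)) = distr M S X \<Otimes>\<^sub>M distr M T Y"
proof (rule pair_measure_eqI[symmetric])
  interpret A: sigma_algebra "space M" \<A> by fact
  interpret B: sigma_algebra "space M" \<B> by fact
  have sub: "\<A> \<subseteq> events" "\<B> \<subseteq> events"
    using indep by (auto simp: indep_sets2_eq)
  have X': "X -` U \<inter> space M \<in> \<A>" if "U \<in> sets S" for U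
    using measurable_sets[OF X that] by simp
  have Y': "Y -` U \<inter> space M \<in> \<B>" if "U \<in> sets T" for U
    using measurable_sets[OF Y that] by simp
  have [measurable]: "X \<in> measurable M S" "Y \<in> measurable M T"
    using measurable_from_subalg[OF subalgebra_sigma X] measurable_from_subalg[OF subalgebra_sigma Y]
      alg sub by auto
  show "sigma_finite_measure (distr M S X)" "sigma_finite_measure (distr M T Y)"
    by (auto intro!: prob_space_imp_sigma_finite prob_space_distr)
  show "sets (distr M S X \<Otimes>\<^sub>M distr M T Y) = sets (distr M (S \<Otimes>\<^sub>M T) (\<lambda>\<omega>. (X \<omega>, Y \<omega>)))"
    by (simp cong: sets_pair_measure_cong)
  fix U V assume "U \<in> sets (distr M S X)" "V \<in> sets (distr M T Y)"
  then have UV [measurable]: "U \<in> sets S" "V \<in> sets T" by simp_all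
  have "(\<lambda>\<omega>. (X \<omega>, Y \<omega>)) -` (U \<times> V) \<inter> space M = (X -` U \<inter> space M) \<inter> (Y -` V \<inter> space M)"
    by auto
  then show "emeasure (distr M S X) U * emeasure (distr M T Y) V =
      emeasure (distr M (S \<Otimes>\<^sub>M T) (\<lambda>\<omega>. (X \<omega>, Y \<omega>))) (U \<times> V)"
    using indep_setD[OF indep X'[OF UV(1)] Y'[OF UV(2)]]
    by (simp add: emeasure_distr emeasure_eq_measure ennreal_mult)
qed

text \<open>Both claims group positions of the list \<open>[A, B, C]\<close>: block 0 against block
  2, then block 1 against the block of 0 and 2. With \<open>B\<close> generated by the sign, the
  second claim separates the sign from the field and the sampling point taken jointly.\<close>

lemma mutually_indep3_imp_indep_set:
  assumes M: "prob_space M" and indep: "mutually_indep3 M A B C"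
    and alg: "sigma_algebra (space M) A" "sigma_algebra (space M) B" "sigma_algebra (space M) C"
  shows "prob_space.indep_set M A C" "prob_space.indep_set M B (sigma_sets (space M) (A \<union> C))"
proof -
  interpret prob_space M by fact
  have ind: "indep_sets (\<lambda>i. [A, B, C] ! i) {..<3::nat}"
    using indep by (simp add: mutually_indep3_def)
  have "Int_stable \<A>" if "sigma_algebra (space M) \<A>" for \<A>
  proof -
    interpret sigma_algebra "space M" \<A> by fact
    show ?thesis by (auto simp: Int_stable_def)
  qed
  then have stable: "Int_stable ([A, B, C] ! i)" if "i \<in> {..<3}" for i
    using alg that by (auto simp: less_Suc_eq numeral_3_eq_3)
  show "indep_set A C"
    using indep_set_collect_sigma[OF ind, of "{0}" "{2}", OF _ _ _ stable]
      sigma_algebra.sigma_sets_eq[OF alg(1)] sigma_algebra.sigma_sets_eq[OF alg(3)]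
    by (simp add: numeral_2_eq_2)
  show "indep_set B (sigma_sets (space M) (A \<union> C))"
    using indep_set_collect_sigma[OF ind, of "{1}" "{0, 2}", OF _ _ _ stable]
      sigma_algebra.sigma_sets_eq[OF alg(2)]
    by (simp add: numeral_2_eq_2)
qed

section \<open>Gaussian increments of the auxiliary field\<close>

text \<open>The description is proper because the chart is injective on \<open>e\<close> and maps it
  onto the two interval ends, so each end has exactly one preimage.\<close>

lemma end_vertex_in_verts:
  assumes G: "graph_with_euclidean_edges G" and e: "e \<in> edges G"
    and y: "y \<in> {lower_end G e, upper_end G e}"
  shows "(THE w. w \<in> e \<and> chart G e w = y) \<in> verts G"
proof -
  have "chart G e ` e = {lower_end G e, upper_end G e}" "inj_on (chart G e) (edge_pts G e \<union> e)"
    and sub: "e \<subseteq> verts G"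
    using G e by (auto simp: graph_with_euclidean_edges_def finite_simple_connected_def)
  then have "\<exists>!w. w \<in> e \<and> chart G e w = y"
    using y by (metis (no_types, lifting) UnI2 image_iff inj_on_eq_iff)
  from theI'[OF this] sub show ?thesis by auto
qed

text \<open>A vertex is its own lower and upper vertex. Any other point has a unique host edge
  because the edge sets are disjoint, and the ends of that edge are vertices.\<close>

lemma
  assumes G: "graph_with_euclidean_edges G" and u: "u \<in> points G"
  shows lower_vert_in_verts: "lower_vert G u \<in> verts G"
    and upper_vert_in_verts: "upper_vert G u \<in> verts G"
proof -
  have "host_edge G u \<in> edges G" if "u \<notin> verts G"
  proof -
    from u that obtain e where e: "e \<in> edges G" "u \<in> edge_pts G e"
      unfolding points_def by blast
    have "e' = e" if "e' \<in> edges G \<and> u \<in> edge_pts G e'" for e'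
      using G that e unfolding graph_with_euclidean_edges_def by blast
    with e have "host_edge G u = e"
      unfolding host_edge_def by (intro the_equality) blast+
    with e(1) show ?thesis by simp
  qed
  then show "lower_vert G u \<in> verts G" "upper_vert G u \<in> verts G"
    using end_vertex_in_verts[OF G] by (simp_all add: lower_vert_def upper_vert_def)
qed

text \<open>A Gaussian field yields normal combinations of unspecified mean; linearity of the
  integral forces that mean to be 0.\<close>

lemma centered_gaussian_combination:
  assumes X: "centered_gaussian_field M T X K" and F: "finite F" "F \<subseteq> T"
  shows "\<exists>\<sigma>\<ge>0. distr M borel (\<lambda>\<omega>. \<Sum>t\<in>F. a t * X t \<omega>) = normal_law 0 \<sigma>"
proof -
  have meas: "X t \<in> borel_measurable M" and zero: "integral\<^sup>L M (X t) = 0" if "t \<in> F" for t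
    using X F(2) that unfolding centered_gaussian_field_def gaussian_field_def by blast+
  have law: "\<exists>m \<sigma>. 0 \<le> \<sigma> \<and> distr M borel (\<lambda>\<omega>. \<Sum>t\<in>F'. b t * X t \<omega>) = normal_law m \<sigma>"
    if "finite F'" "F' \<subseteq> T" for F' b
    using X that unfolding centered_gaussian_field_def gaussian_field_def by blast
  \<comment> \<open>Linearity requires integrable summands. The combination over \<open>{t}\<close>
    with coefficient 1 shows that \<open>X t\<close> is itself normal, hence integrable.\<close>
  have int: "integrable M (X t)" if t: "t \<in> F" for t
  proof -
    obtain m \<sigma> where "0 \<le> \<sigma>" "distr M borel (X t) = normal_law m \<sigma>"
      using law[of "{t}" "\<lambda>_. 1"] t F by auto
    then show ?thesis
      using meas[OF t] by (rule integrable_normal_law)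
  qed
  obtain m \<sigma> where \<sigma>: "0 \<le> \<sigma>" "distr M borel (\<lambda>\<omega>. \<Sum>t\<in>F. a t * X t \<omega>) = normal_law m \<sigma>"
    using law[OF F] by blast
  have "m = integral\<^sup>L M (\<lambda>\<omega>. \<Sum>t\<in>F. a t * X t \<omega>)"
    by (rule integral_normal_law[OF \<sigma>, symmetric]) (auto intro!: borel_measurable_sum borel_measurable_times meas)
  also have "\<dots> = 0"
    by (subst Bochner_Integration.integral_sum) (simp_all add: int zero)
  finally show ?thesis
    using \<sigma> by blast
qed

lemma sum_of_bool_eq_mult:
  fixes h :: "'i \<Rightarrow> real"
  assumes "finite A" "x \<in> A"
  shows "(\<Sum>t\<in>A. of_bool (t = x) * h t) = h x"
  using assms by (simp add: of_bool_def if_distrib[of "\<lambda>c. c * _"] cong: if_cong)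

lemma vertex_extension_diff_eq:
  assumes G: "graph_with_euclidean_edges G" and u: "u \<in> points G" and v: "v \<in> points G"
  shows "\<exists>a. \<forall>\<omega>. vertex_extension G W u \<omega> - vertex_extension G W v \<omega> =
    (\<Sum>w\<in>verts G. a w * W w \<omega>)"
proof -
  have fin: "finite (verts G)"
    using G by (simp add: graph_with_euclidean_edges_def finite_simple_connected_def)
  \<comment> \<open>The two end vertices coincide when \<open>p\<close> is a vertex, so their
    contributions are added instead of being assigned by cases.\<close>
  define a where "a p w = (1 - rel_pos G p) * of_bool (w = lower_vert G p) +
    rel_pos G p * of_bool (w = upper_vert G p)" for p w
  have "vertex_extension G W p \<omega> = (\<Sum>w\<in>verts G. a p w * W w \<omega>)" if "p \<in> points G" for p \<omega>
    unfolding a_def vertex_extension_def distrib_right sum.distrib mult.assoc sum_distrib_left[symmetric]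
    using fin lower_vert_in_verts[OF G that] upper_vert_in_verts[OF G that]
    by (simp add: sum_of_bool_eq_mult)
  then have "\<forall>\<omega>. vertex_extension G W u \<omega> - vertex_extension G W v \<omega> =
      (\<Sum>w\<in>verts G. (a u w - a v w) * W w \<omega>)"
    using u v by (simp add: left_diff_distrib sum_subtractf)
  then show ?thesis
    by (rule exI[of _ "\<lambda>w. a u w - a v w"])
qed

text \<open>At most two bridge times matter, the chart values of those among \<open>u\<close> and
  \<open>v\<close> that lie on \<open>e\<close>. A point off \<open>e\<close> gets zero
  coefficients, matching the zero value of its edge field.\<close>

lemma edge_field_diff_eq:
  assumes G: "graph_with_euclidean_edges G" and e: "e \<in> edges G"
  shows "\<exists>F a. finite F \<and> F \<subseteq> {lower_end G e..upper_end G e} \<and>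
    (\<forall>\<omega>. edge_field G B e u \<omega> - edge_field G B e v \<omega> = (\<Sum>t\<in>F. a t * B e t \<omega>))"
proof -
  define F where "F = chart G e ` ({u, v} \<inter> edge_pts G e)"
  define a :: "'a \<Rightarrow> real \<Rightarrow> real"
    where "a p t = of_bool (p \<in> edge_pts G e) * of_bool (t = chart G e p)" for p t
  have "chart G e ` edge_pts G e = {lower_end G e<..<upper_end G e}"
    using G e by (simp add: graph_with_euclidean_edges_def)
  moreover have "F \<subseteq> chart G e ` edge_pts G e"
    unfolding F_def by (intro image_mono) simp
  ultimately have sub: "F \<subseteq> {lower_end G e..upper_end G e}"
    by auto
  have fin: "finite F"
    by (simp add: F_def)
  have "edge_field G B e p \<omega> = (\<Sum>t\<in>F. a p t * B e t \<omega>)" if "p \<in> {u, v}" for p \<omega>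
    unfolding a_def edge_field_def mult.assoc sum_distrib_left[symmetric]
    using fin that by (auto simp: sum_of_bool_eq_mult F_def)
  then have "\<forall>\<omega>. edge_field G B e u \<omega> - edge_field G B e v \<omega> = (\<Sum>t\<in>F. (a u t - a v t) * B e t \<omega>)"
    by (simp add: left_diff_distrib sum_subtractf)
  with fin sub show ?thesis
    by (intro exI[of _ F] exI[of _ "\<lambda>t. a u t - a v t"]) simp
qed

text \<open>The standard deviation is left existential here; it is identified later by computing the
  variance.\<close>

lemma auxiliary_field_diff_normal:
  assumes M: "prob_space M" and G: "graph_with_euclidean_edges G" and Z: "auxiliary_field M G u0 Z"
    and u: "u \<in> points G" and v: "v \<in> points G"
  shows "\<exists>\<sigma>\<ge>0. distr M borel (\<lambda>\<omega>. Z u \<omega> - Z v \<omega>) = normal_law 0 \<sigma>"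
proof -
  interpret prob_space M by fact
  let ?T = "\<lambda>e. {lower_end G e..upper_end G e}"
  let ?S = "SIGMA e:edges G. ?T e"
  obtain W B where
    W: "centered_gaussian_field M (verts G) W (matrix_inv_on (verts G) (precision_matrix G u0))"
    and B: "\<And>e. e \<in> edges G \<Longrightarrow> brownian_bridge M (lower_end G e) (upper_end G e) (B e)"
    and indep_B: "indep_sets (\<lambda>e. generated_events M (?T e) (B e)) (edges G)"
    and indep_WB: "indep_set (generated_events M (verts G) W) (generated_events M ?S (\<lambda>(e, t). B e t))"
    and Z_eq: "\<And>p \<omega>. p \<in> points G \<Longrightarrow> \<omega> \<in> space M \<Longrightarrow>
        Z p \<omega> = vertex_extension G W p \<omega> + (\<Sum>e\<in>edges G. edge_field G B e p \<omega>)"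
    using Z unfolding auxiliary_field_def by blast
  obtain a where a: "\<And>\<omega>. vertex_extension G W u \<omega> - vertex_extension G W v \<omega> =
      (\<Sum>w\<in>verts G. a w * W w \<omega>)"
    using vertex_extension_diff_eq[OF G u v] by blast
  have "\<forall>e\<in>edges G. \<exists>F b. finite F \<and> F \<subseteq> ?T e \<and>
    (\<forall>\<omega>. edge_field G B e u \<omega> - edge_field G B e v \<omega> = (\<Sum>t\<in>F. b t * B e t \<omega>))"
    using edge_field_diff_eq[OF G] by blast
  \<comment> \<open>Choice is applied twice: first for the bridge times on each edge, then for their
    coefficients.\<close>
  from bchoice[OF this] obtain F where "\<forall>e\<in>edges G. \<exists>b. finite (F e) \<and> F e \<subseteq> ?T e \<and>
    (\<forall>\<omega>. edge_field G B e u \<omega> - edge_field G B e v \<omega> = (\<Sum>t\<in>F e. b t * B e t \<omega>))"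
    by blast
  from bchoice[OF this] obtain b where
    F: "\<And>e. e \<in> edges G \<Longrightarrow> finite (F e)" "\<And>e. e \<in> edges G \<Longrightarrow> F e \<subseteq> ?T e"
    and b: "\<And>e \<omega>. e \<in> edges G \<Longrightarrow>
      edge_field G B e u \<omega> - edge_field G B e v \<omega> = (\<Sum>t\<in>F e. b e t * B e t \<omega>)"
    by blast
  define D where "D \<omega> = (\<Sum>w\<in>verts G. a w * W w \<omega>)" for \<omega>
  define E where "E e \<omega> = (\<Sum>t\<in>F e. b e t * B e t \<omega>)" for e \<omega>
  have "finite (verts G)"
    using G by (simp add: graph_with_euclidean_edges_def finite_simple_connected_def)
  then obtain \<sigma> where \<sigma>: "0 \<le> \<sigma>" "distr M borel D = normal_law 0 \<sigma>"
    using centered_gaussian_combination[OF W, of "verts G" a] by (auto simp: D_def[abs_def])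
  have "\<forall>e\<in>edges G. \<exists>\<tau>\<ge>0. distr M borel (E e) = normal_law 0 \<tau>"
    using centered_gaussian_combination[OF _ F] B unfolding E_def[abs_def] brownian_bridge_def by blast
  then obtain \<tau> where \<tau>: "\<And>e. e \<in> edges G \<Longrightarrow> 0 \<le> \<tau> e"
      "\<And>e. e \<in> edges G \<Longrightarrow> distr M borel (E e) = normal_law 0 (\<tau> e)"
    by metis
  \<comment> \<open>Each \<open>E e\<close> uses only the bridge of its own edge, so independence of
    the bridges carries over.\<close>
  have "indep_vars (\<lambda>_. borel) E (edges G)"
  proof (rule indep_vars_if_indep_sets[OF indep_B sigma_algebra_generated_events])
    fix e assume e: "e \<in> edges G"
    show "E e \<in> borel_measurable (sigma (space M) (generated_events M (?T e) (B e)))"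
      unfolding E_def[abs_def]
      by (intro borel_measurable_sum borel_measurable_times borel_measurable_const measurable_generated_events)
        (use F(2)[OF e] in blast)
  qed
  from distr_sum_normal_law[OF this \<tau>]
  have sum: "distr M borel (\<lambda>\<omega>. \<Sum>e\<in>edges G. E e \<omega>) = normal_law 0 (sqrt (\<Sum>e\<in>edges G. (\<tau> e)\<^sup>2))"
    by simp
  \<comment> \<open>The edge sum involves all bridges at once, hence the vertex field must be
    independent of the joint family indexed by pairs \<open>(e, t)\<close>.\<close>
  have "indep_var borel D borel (\<lambda>\<omega>. \<Sum>e\<in>edges G. E e \<omega>)"
  proof (rule indep_var_if_indep_set[OF indep_WB sigma_algebra_generated_events sigma_algebra_generated_events])
    show "D \<in> borel_measurable (sigma (space M) (generated_events M (verts G) W))"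
      unfolding D_def[abs_def]
      by (intro borel_measurable_sum borel_measurable_times borel_measurable_const measurable_generated_events)
    have "B e t \<in> borel_measurable (sigma (space M) (generated_events M ?S (\<lambda>(e, t). B e t)))"
      if "e \<in> edges G" "t \<in> F e" for e t
      using measurable_generated_events[of "(e, t)" ?S "\<lambda>(e, t). B e t" M] that F(2)[OF that(1)] by auto
    then show "(\<lambda>\<omega>. \<Sum>e\<in>edges G. E e \<omega>) \<in>
        borel_measurable (sigma (space M) (generated_events M ?S (\<lambda>(e, t). B e t)))"
      unfolding E_def by (intro borel_measurable_sum borel_measurable_times borel_measurable_const)
  qed
  from distr_add_normal_law[OF this \<sigma>(1) _ \<sigma>(2) sum]
  have "distr M borel (\<lambda>\<omega>. D \<omega> + (\<Sum>e\<in>edges G. E e \<omega>)) =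
      normal_law 0 (sqrt (\<sigma>\<^sup>2 + (\<Sum>e\<in>edges G. (\<tau> e)\<^sup>2)))"
    by (simp add: sum_nonneg)
  moreover have "Z u \<omega> - Z v \<omega> = D \<omega> + (\<Sum>e\<in>edges G. E e \<omega>)" if "\<omega> \<in> space M" for \<omega>
  proof -
    have "(\<Sum>e\<in>edges G. E e \<omega>) = (\<Sum>e\<in>edges G. edge_field G B e u \<omega>) - (\<Sum>e\<in>edges G. edge_field G B e v \<omega>)"
      unfolding sum_subtractf[symmetric] E_def by (rule sum.cong) (simp_all add: b)
    with that show ?thesis
      by (simp add: Z_eq u v D_def a[symmetric])
  qed
  then have "distr M borel (\<lambda>\<omega>. Z u \<omega> - Z v \<omega>) = distr M borel (\<lambda>\<omega>. D \<omega> + (\<Sum>e\<in>edges G. E e \<omega>))"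
    by (intro distr_cong) simp_all
  ultimately show ?thesis
    by (intro exI[of _ "sqrt (\<sigma>\<^sup>2 + (\<Sum>e\<in>edges G. (\<tau> e)\<^sup>2))"]) (simp add: sum_nonneg)
qed

section \<open>Transitive covariogram and random sampling\<close>

text \<open>The product is dominated by the sum of the squares, by the arithmetic-geometric mean
  inequality.\<close>

lemma integrable_mult_of_square:
  fixes f g :: "'b \<Rightarrow> real"
  assumes [measurable]: "f \<in> borel_measurable N" "g \<in> borel_measurable N"
    and sq: "integrable N (\<lambda>x. (f x)\<^sup>2)" "integrable N (\<lambda>x. (g x)\<^sup>2)"
  shows "integrable N (\<lambda>x. f x * g x)"
proof (rule Bochner_Integration.integrable_bound)
  show "integrable N (\<lambda>x. (f x)\<^sup>2 + (g x)\<^sup>2)"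
    using sq by (rule Bochner_Integration.integrable_add)
  have "\<bar>a * b\<bar> \<le> a\<^sup>2 + b\<^sup>2" for a b :: real
  proof -
    have "2 * (\<bar>a\<bar> * \<bar>b\<bar>) \<le> a\<^sup>2 + b\<^sup>2"
      using sum_squares_bound[of "\<bar>a\<bar>" "\<bar>b\<bar>"] by simp
    moreover have "0 \<le> \<bar>a\<bar> * \<bar>b\<bar>"
      by simp
    ultimately show ?thesis
      unfolding abs_mult by linarith
  qed
  then show "AE x in N. norm (f x * g x) \<le> norm ((f x)\<^sup>2 + (g x)\<^sup>2)"
    by simp
qed measurable

lemma borel_measurable_transitive_covariogram [measurable]:
  assumes [measurable]: "f \<in> borel_measurable borel"
  shows "transitive_covariogram f \<in> borel_measurable borel"
  unfolding transitive_covariogram_def[abs_def] by measurable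

text \<open>Substitute \<open>b - x\<close> for \<open>x\<close>. The substitution rule holds even
  if the integrals take the default value 0, so no integrability is required.\<close>

lemma integral_reflected_product:
  fixes f :: "real \<Rightarrow> real"
  shows "(LINT x|lborel. f (a - x) * f (b - x)) = transitive_covariogram f (a - b)"
  unfolding transitive_covariogram_def
  by (subst lborel_integral_real_affine[where c = "-1" and t = b]) (simp_all add: algebra_simps)

lemma integrable_shifted_product:
  fixes f :: "real \<Rightarrow> real"
  assumes [measurable]: "f \<in> borel_measurable borel" and sq: "integrable lborel (\<lambda>x. (f x)\<^sup>2)"
  shows "integrable lborel (\<lambda>x. f (x + h) * f x)"
  using lborel_integrable_real_affine[OF sq, of 1 h]
  by (intro integrable_mult_of_square sq) (simp_all add: add.commute)

text \<open>Evaluating \<open>g\<close> at \<open>\<sigma> * z\<close> under the standard density,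
  rather than using a density of \<open>D\<close>, keeps the formula valid for \<sigma> = 0, as
  happens when \<open>u = v\<close>. The constant stands outside the integral as in
  \<open>C_Y\<close>.\<close>

lemma
  assumes pos: "0 \<le> \<sigma>" and law: "distr M borel D = normal_law 0 \<sigma>"
    and D [measurable]: "D \<in> borel_measurable M"
    and g [measurable]: "g \<in> borel_measurable borel"
  shows integrable_normal_law_iff:
      "integrable M (\<lambda>\<omega>. g (D \<omega>)) \<longleftrightarrow> integrable lborel (\<lambda>z. g (\<sigma> * z) * exp (- z\<^sup>2 / 2))"
    and integral_normal_law_eq:
      "integral\<^sup>L M (\<lambda>\<omega>. g (D \<omega>)) = 1 / sqrt (2 * pi) * (LINT z|lborel. g (\<sigma> * z) * exp (- z\<^sup>2 / 2))"
proof -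
  have law': "distr M borel D = distr std_normal_distribution borel (\<lambda>z. \<sigma> * z)"
    using law normal_law_eq_distr[OF pos, of 0] by simp
  have \<sigma>: "(\<lambda>z. \<sigma> * z) \<in> borel_measurable std_normal_distribution"
    by simp
  have dens: "std_normal_density z *\<^sub>R g (\<sigma> * z) = 1 / sqrt (2 * pi) * (g (\<sigma> * z) * exp (- z\<^sup>2 / 2))" for z
    by (simp add: std_normal_density_def)
  have "integrable M (\<lambda>\<omega>. g (D \<omega>)) \<longleftrightarrow> integrable std_normal_distribution (\<lambda>z. g (\<sigma> * z))"
    using integrable_distr_eq[OF D g] integrable_distr_eq[OF \<sigma> g] by (simp only: law')
  also have "\<dots> \<longleftrightarrow> integrable lborel (\<lambda>z. std_normal_density z *\<^sub>R g (\<sigma> * z))"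
    by (rule integrable_density) simp_all
  also have "\<dots> \<longleftrightarrow> integrable lborel (\<lambda>z. g (\<sigma> * z) * exp (- z\<^sup>2 / 2))"
    unfolding dens by (rule integrable_mult_left_iff[THEN trans]) simp
  finally show "integrable M (\<lambda>\<omega>. g (D \<omega>)) \<longleftrightarrow> integrable lborel (\<lambda>z. g (\<sigma> * z) * exp (- z\<^sup>2 / 2))" .
  have "integral\<^sup>L M (\<lambda>\<omega>. g (D \<omega>)) = integral\<^sup>L std_normal_distribution (\<lambda>z. g (\<sigma> * z))"
    using integral_distr[OF D g] integral_distr[OF \<sigma> g] by (simp only: law')
  also have "\<dots> = integral\<^sup>L lborel (\<lambda>z. std_normal_density z *\<^sub>R g (\<sigma> * z))"
    by (rule integral_density) simp_all
  also have "\<dots> = 1 / sqrt (2 * pi) * (LINT z|lborel. g (\<sigma> * z) * exp (- z\<^sup>2 / 2))"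
    unfolding dens by (rule integral_mult_right_zero)
  finally show "integral\<^sup>L M (\<lambda>\<omega>. g (D \<omega>)) =
      1 / sqrt (2 * pi) * (LINT z|lborel. g (\<sigma> * z) * exp (- z\<^sup>2 / 2))" .
qed

text \<open>Dividing by the density of \<open>X\<close> turns the law of \<open>X\<close> into Lebesgue measure.\<close>

context prob_space
begin

text \<open>\<open>distributed\<close> speaks only of the \<open>ennreal\<close> version of
  \<open>p\<close>; positivity makes this version determine \<open>p\<close>.\<close>

lemma borel_measurable_density:
  assumes "distributed M lborel X (\<lambda>x. ennreal (p x))" "\<And>x. 0 < p x"
  shows "p \<in> borel_measurable borel"
  using distributed_real_measurable[of lborel p M X] assms by (simp add: less_imp_le)

text \<open>The Tonelli version, free of integrability assumptions; it is what establishes the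
  finite second moments.\<close>

lemma nn_integral_div_density:
  fixes h :: "'b \<times> real \<Rightarrow> real"
  assumes V [measurable]: "V \<in> measurable M S"
    and X: "distributed M lborel X (\<lambda>x. ennreal (p x))"
    and indep: "distr M (S \<Otimes>\<^sub>M lborel) (\<lambda>\<omega>. (V \<omega>, X \<omega>)) = distr M S V \<Otimes>\<^sub>M distr M lborel X"
    and pos: "\<And>x. 0 < p x" and h [measurable]: "h \<in> borel_measurable (S \<Otimes>\<^sub>M lborel)"
    and nonneg: "\<And>y. 0 \<le> h y"
  shows "(\<integral>\<^sup>+\<omega>. ennreal (h (V \<omega>, X \<omega>) / p (X \<omega>)) \<partial>M) =
    (\<integral>\<^sup>+\<omega>. (\<integral>\<^sup>+x. ennreal (h (V \<omega>, x)) \<partial>lborel) \<partial>M)"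
proof -
  have [measurable]: "p \<in> borel_measurable borel"
    using X pos by (rule borel_measurable_density)
  have XM [measurable]: "X \<in> measurable M lborel"
    using X by (rule distributed_measurable)
  let ?D = "density lborel (\<lambda>x. ennreal (p x))"
  have joint: "distr M (S \<Otimes>\<^sub>M lborel) (\<lambda>\<omega>. (V \<omega>, X \<omega>)) = distr M S V \<Otimes>\<^sub>M ?D"
    using indep by (simp add: distributed_distr_eq_density[OF X])
  interpret D: prob_space ?D
    using prob_space_distr[OF XM] by (simp add: distributed_distr_eq_density[OF X])
  have [measurable_cong]: "sets ?D = sets lborel"
    by simp
  have "(\<integral>\<^sup>+\<omega>. ennreal (h (V \<omega>, X \<omega>) / p (X \<omega>)) \<partial>M) =
      (\<integral>\<^sup>+y. ennreal (h y / p (snd y)) \<partial>distr M (S \<Otimes>\<^sub>M lborel) (\<lambda>\<omega>. (V \<omega>, X \<omega>)))"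
    by (subst nn_integral_distr) simp_all
  also have "\<dots> = (\<integral>\<^sup>+v. (\<integral>\<^sup>+x. ennreal (h (v, x) / p x) \<partial>?D) \<partial>distr M S V)"
    unfolding joint by (subst D.nn_integral_fst[symmetric]) simp_all
  also have "\<dots> = (\<integral>\<^sup>+v. (\<integral>\<^sup>+x. ennreal (h (v, x)) \<partial>lborel) \<partial>distr M S V)"
  proof (rule nn_integral_cong)
    fix v assume "v \<in> space (distr M S V)"
    then have [measurable]: "v \<in> space S" by simp
    have "ennreal (p x) * ennreal (h (v, x) / p x) = ennreal (h (v, x))" for x
      using pos[of x] nonneg by (simp add: ennreal_mult[symmetric])
    then show "(\<integral>\<^sup>+x. ennreal (h (v, x) / p x) \<partial>?D) = (\<integral>\<^sup>+x. ennreal (h (v, x)) \<partial>lborel)"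
      by (subst nn_integral_density) simp_all
  qed
  also have "\<dots> = (\<integral>\<^sup>+\<omega>. (\<integral>\<^sup>+x. ennreal (h (V \<omega>, x)) \<partial>lborel) \<partial>M)"
    by (subst nn_integral_distr) simp_all
  finally show ?thesis .
qed

text \<open>The Fubini version for signed \<open>h\<close>. Integrability of the inner integral is
  recorded as well, since it later yields integrability of the covariogram against the Gaussian
  weight.\<close>

lemma
  fixes h :: "'b \<times> real \<Rightarrow> real"
  assumes V [measurable]: "V \<in> measurable M S"
    and X: "distributed M lborel X (\<lambda>x. ennreal (p x))"
    and indep: "distr M (S \<Otimes>\<^sub>M lborel) (\<lambda>\<omega>. (V \<omega>, X \<omega>)) = distr M S V \<Otimes>\<^sub>M distr M lborel X"
    and pos: "\<And>x. 0 < p x" and h [measurable]: "h \<in> borel_measurable (S \<Otimes>\<^sub>M lborel)"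
    and int: "integrable M (\<lambda>\<omega>. h (V \<omega>, X \<omega>) / p (X \<omega>))"
  shows integrable_div_density: "integrable M (\<lambda>\<omega>. LINT x|lborel. h (V \<omega>, x))"
    and integral_div_density:
      "integral\<^sup>L M (\<lambda>\<omega>. h (V \<omega>, X \<omega>) / p (X \<omega>)) = integral\<^sup>L M (\<lambda>\<omega>. LINT x|lborel. h (V \<omega>, x))"
proof -
  have [measurable]: "p \<in> borel_measurable borel"
    using X pos by (rule borel_measurable_density)
  have XM [measurable]: "X \<in> measurable M lborel"
    using X by (rule distributed_measurable)
  let ?D = "density lborel (\<lambda>x. ennreal (p x))"
  have joint: "distr M (S \<Otimes>\<^sub>M lborel) (\<lambda>\<omega>. (V \<omega>, X \<omega>)) = distr M S V \<Otimes>\<^sub>M ?D"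
    using indep by (simp add: distributed_distr_eq_density[OF X])
  interpret D: prob_space ?D
    using prob_space_distr[OF XM] by (simp add: distributed_distr_eq_density[OF X])
  interpret V: prob_space "distr M S V"
    by (rule prob_space_distr) simp
  interpret VD: pair_prob_space "distr M S V" ?D ..
  have [measurable_cong]: "sets ?D = sets lborel"
    by simp
  define k where "k y = h y / p (snd y)" for y
  have k [measurable]: "k \<in> borel_measurable (S \<Otimes>\<^sub>M lborel)"
    unfolding k_def by measurable
  have VX: "(\<lambda>\<omega>. (V \<omega>, X \<omega>)) \<in> measurable M (S \<Otimes>\<^sub>M lborel)"
    by measurable
  have int': "integrable (distr M S V \<Otimes>\<^sub>M ?D) k"
    using int unfolding joint[symmetric] integrable_distr_eq[OF VX k]
    by (simp add: k_def)
  have inner: "(LINT x|?D. k (v, x)) = (LINT x|lborel. h (v, x))" if "v \<in> space S" for v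
  proof -
    note that [measurable]
    have "p x *\<^sub>R k (v, x) = h (v, x)" for x
      using pos[of x] by (simp add: k_def)
    then show ?thesis
      using pos by (subst integral_density) (simp_all add: less_imp_le)
  qed
  have "integrable (distr M S V) (\<lambda>v. LINT x|?D. k (v, x))"
    using VD.integrable_fst'[OF int'] .
  also have "?this \<longleftrightarrow> integrable (distr M S V) (\<lambda>v. LINT x|lborel. h (v, x))"
    by (rule Bochner_Integration.integrable_cong) (simp_all add: inner)
  also have "\<dots> \<longleftrightarrow> integrable M (\<lambda>\<omega>. LINT x|lborel. h (V \<omega>, x))"
    by (rule integrable_distr_eq) measurable
  finally show "integrable M (\<lambda>\<omega>. LINT x|lborel. h (V \<omega>, x))" .
  have "integral\<^sup>L M (\<lambda>\<omega>. h (V \<omega>, X \<omega>) / p (X \<omega>)) = integral\<^sup>L (distr M S V \<Otimes>\<^sub>M ?D) k"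
    unfolding joint[symmetric] integral_distr[OF VX k]
    by (simp add: k_def)
  also have "\<dots> = (LINT v|distr M S V. LINT x|?D. k (v, x))"
    using VD.integral_fst'[OF int'] by simp
  also have "\<dots> = (LINT v|distr M S V. LINT x|lborel. h (v, x))"
    by (rule Bochner_Integration.integral_cong) (simp_all add: inner)
  also have "\<dots> = integral\<^sup>L M (\<lambda>\<omega>. LINT x|lborel. h (V \<omega>, x))"
    by (rule integral_distr) measurable
  finally show "integral\<^sup>L M (\<lambda>\<omega>. h (V \<omega>, X \<omega>) / p (X \<omega>)) =
      integral\<^sup>L M (\<lambda>\<omega>. LINT x|lborel. h (V \<omega>, x))" .
qed

end

section \<open>Moments of the random sign\<close>

context prob_space
begin

text \<open>The two events are disjoint and their probabilities add up to 1.\<close>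

lemma AE_rademacher:
  fixes \<epsilon> :: "'a \<Rightarrow> real"
  assumes [measurable]: "\<epsilon> \<in> borel_measurable M"
    and "prob {\<omega> \<in> space M. \<epsilon> \<omega> = 1} = 1 / 2" "prob {\<omega> \<in> space M. \<epsilon> \<omega> = -1} = 1 / 2"
  shows "AE \<omega> in M. \<epsilon> \<omega> = 1 \<or> \<epsilon> \<omega> = -1"
proof -
  have "prob ({\<omega> \<in> space M. \<epsilon> \<omega> = 1} \<union> {\<omega> \<in> space M. \<epsilon> \<omega> = -1}) = 1"
    using assms by (subst finite_measure_Union) auto
  then have "AE \<omega> in M. \<omega> \<in> {\<omega> \<in> space M. \<epsilon> \<omega> = 1} \<union> {\<omega> \<in> space M. \<epsilon> \<omega> = -1}"
    by (subst (asm) prob_eq_1) simp_all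
  then show ?thesis
    by eventually_elim auto
qed

text \<open>Almost surely the sign is bounded by 1 and equals the difference of the indicators of
  its two values, whose expectations cancel.\<close>

lemma rademacher_expectation:
  fixes \<epsilon> :: "'a \<Rightarrow> real"
  assumes eps [measurable]: "\<epsilon> \<in> borel_measurable M"
    and half: "prob {\<omega> \<in> space M. \<epsilon> \<omega> = 1} = 1 / 2" "prob {\<omega> \<in> space M. \<epsilon> \<omega> = -1} = 1 / 2"
  shows "integrable M \<epsilon>" "expectation \<epsilon> = 0"
proof -
  note AE = AE_rademacher[OF assms]
  show "integrable M \<epsilon>"
    using AE by (intro integrable_const_bound[of _ 1]) auto
  have int: "integrable M (indicat_real {\<omega> \<in> space M. \<epsilon> \<omega> = c})" for c
    by (intro integrable_real_indicator) (simp_all add: emeasure_eq_measure)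
  have "expectation \<epsilon> = expectation (\<lambda>\<omega>. indicator {\<omega> \<in> space M. \<epsilon> \<omega> = 1} \<omega> -
      indicator {\<omega> \<in> space M. \<epsilon> \<omega> = -1} \<omega>)"
    using AE by (intro integral_cong_AE) (auto elim!: eventually_mono split: split_indicator)
  also have "\<dots> = 0"
    using half by (subst Bochner_Integration.integral_diff[OF int int]) simp
  finally show "expectation \<epsilon> = 0" .
qed

end

text \<open>Integrability claims accompany the mean, the covariogram and the covariance formula,
  because an integral that does not exist has the default value 0 and an equation alone would say
  too little.\<close>

theorem proposition3p4:
  fixes M :: "'w measure" and G :: "'a euclidean_graph" and u0 :: 'a
    and Z :: "'a \<Rightarrow> 'w \<Rightarrow> real" and \<epsilon> X :: "'w \<Rightarrow> real"
    and f \<pi>X :: "real \<Rightarrow> real"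
  assumes "prob_space M"
    and "graph_with_euclidean_edges G"
    and "u0 \<in> verts G"
    and "auxiliary_field M G u0 Z"
    and "f \<in> borel_measurable borel"
    and "integrable lborel (\<lambda>x. (f x)\<^sup>2)"
    and "\<epsilon> \<in> borel_measurable M"
    and "measure M {\<omega> \<in> space M. \<epsilon> \<omega> = 1} = 1 / 2"
    and "measure M {\<omega> \<in> space M. \<epsilon> \<omega> = -1} = 1 / 2"
    and "\<And>x. 0 < \<pi>X x"
    and "distributed M lborel X (\<lambda>x. ennreal (\<pi>X x))"
    and "mutually_indep3 M (generated_events M (points G) Z)
           (generated_events_rv M \<epsilon>) (generated_events_rv M X)"
  shows "(\<forall>u\<in>points G. integrable M (dilution_field f \<pi>X \<epsilon> X Z u) \<and>
            integrable M (\<lambda>\<omega>. (dilution_field f \<pi>X \<epsilon> X Z u \<omega>)\<^sup>2) \<and>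
            integral\<^sup>L M (dilution_field f \<pi>X \<epsilon> X Z u) = 0) \<and>
         isotropic_wrt (points G) (resistance_metric M Z)
           (\<lambda>u v. covariance M (dilution_field f \<pi>X \<epsilon> X Z u) (dilution_field f \<pi>X \<epsilon> X Z v)) \<and>
         (\<forall>h. integrable lborel (\<lambda>x. f (x + h) * f x)) \<and>
         (\<forall>u\<in>points G. \<forall>v\<in>points G.
            integrable lborel (\<lambda>z. transitive_covariogram f (sqrt (resistance_metric M Z u v) * z)
                                    * exp (- z\<^sup>2 / 2)) \<and>
            covariance M (dilution_field f \<pi>X \<epsilon> X Z u) (dilution_field f \<pi>X \<epsilon> X Z v)
              = C_Y f (resistance_metric M Z u v))"
proof -
  interpret prob_space M by fact
  note f [measurable] = assms(5) and sq = assms(6) and eps [measurable] = assms(7)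
    and pos = assms(10) and dens = assms(11)
  have X [measurable]: "X \<in> borel_measurable M"
    using distributed_measurable[OF dens] by simp
  have p [measurable]: "\<pi>X \<in> borel_measurable borel"
    using dens pos by (rule borel_measurable_density)

  \<comment> \<open>Independence of the field, the sign and the sampling point\<close>
  let ?A = "generated_events M (points G) Z" and ?C = "generated_events_rv M X"
  let ?AC = "sigma_sets (space M) (?A \<union> ?C)"
  have alg: "sigma_algebra (space M) ?A" "sigma_algebra (space M) (generated_events_rv M \<epsilon>)"
    "sigma_algebra (space M) ?C"
    unfolding generated_events_rv_def by (rule sigma_algebra_generated_events)+
  have indep_ZX: "indep_set ?A ?C" and indep_eps: "indep_set (generated_events_rv M \<epsilon>) ?AC"
    using mutually_indep3_imp_indep_set[OF assms(1,12) alg] by auto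
  have sub: "?A \<subseteq> Pow (space M)" "?C \<subseteq> Pow (space M)"
    using alg by (simp_all add: sigma_algebra_iff2)
  have ZA: "Z u \<in> borel_measurable (sigma (space M) ?A)" if "u \<in> points G" for u
    using that by (rule measurable_generated_events)
  have XC: "X \<in> borel_measurable (sigma (space M) ?C)"
    unfolding generated_events_rv_def
    by (rule measurable_generated_events[of "()" "{()}" "\<lambda>_. X"]) simp
  have epsB: "\<epsilon> \<in> borel_measurable (sigma (space M) (generated_events_rv M \<epsilon>))"
    unfolding generated_events_rv_def
    by (rule measurable_generated_events[of "()" "{()}" "\<lambda>_. \<epsilon>"]) simp
  have Z [measurable]: "Z u \<in> borel_measurable M" if "u \<in> points G" for u
    using indep_ZX
    by (intro measurable_from_subalg[OF subalgebra_sigma[OF alg(1)] ZA[OF that]]) (simp add: indep_sets2_eq)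

  \<comment> \<open>The field stripped of its random sign\<close>
  define g where "g u \<omega> = f (Z u \<omega> - X \<omega>) / sqrt (\<pi>X (X \<omega>))" for u \<omega>
  have g [measurable]: "g u \<in> borel_measurable M" if "u \<in> points G" for u
    using Z[OF that] unfolding g_def[abs_def] by measurable
  \<comment> \<open>The two square roots multiply to the density itself, which gives the quotient
    treated by \<open>integral_div_density\<close>.\<close>
  have g_mult: "g u \<omega> * g v \<omega> = f (Z u \<omega> - X \<omega>) * f (Z v \<omega> - X \<omega>) / \<pi>X (X \<omega>)" for u v \<omega>
    using pos[of "X \<omega>"] by (simp add: g_def)
  have joint: "distr M ((borel \<Otimes>\<^sub>M borel) \<Otimes>\<^sub>M lborel) (\<lambda>\<omega>. ((Z u \<omega>, Z v \<omega>), X \<omega>)) =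
      distr M (borel \<Otimes>\<^sub>M borel) (\<lambda>\<omega>. (Z u \<omega>, Z v \<omega>)) \<Otimes>\<^sub>M distr M lborel X"
    if "u \<in> points G" "v \<in> points G" for u v
    using ZA that XC
    by (intro distr_Pair_if_indep_set[OF indep_ZX alg(1,3)] measurable_Pair) simp_all
  have pair [measurable]: "(\<lambda>\<omega>. (Z u \<omega>, Z v \<omega>)) \<in> measurable M (borel \<Otimes>\<^sub>M borel)"
    if "u \<in> points G" "v \<in> points G" for u v
    using that by (intro measurable_Pair Z)

  \<comment> \<open>Finite second moments\<close>
  have int_gg: "integrable M (\<lambda>\<omega>. (g u \<omega>)\<^sup>2)" if u: "u \<in> points G" for u
  proof (rule integrableI_nonneg)
    \<comment> \<open>One field value suffices here; repeating it as
      \<open>(Z u \<omega>, Z u \<omega>)\<close> allows reuse of the joint law of pairs.\<close>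
    let ?h = "\<lambda>y::(real \<times> real) \<times> real. (f (fst (fst y) - snd y))\<^sup>2"
    have "(\<integral>\<^sup>+\<omega>. ennreal ((g u \<omega>)\<^sup>2) \<partial>M) =
        (\<integral>\<^sup>+\<omega>. ennreal (?h ((Z u \<omega>, Z u \<omega>), X \<omega>) / \<pi>X (X \<omega>)) \<partial>M)"
      using g_mult[of u _ u] by (simp add: power2_eq_square)
    also have "\<dots> = (\<integral>\<^sup>+\<omega>. (\<integral>\<^sup>+x. ennreal (?h ((Z u \<omega>, Z u \<omega>), x)) \<partial>lborel) \<partial>M)"
      by (rule nn_integral_div_density[OF pair[OF u u] dens joint[OF u u] pos]) simp_all
    \<comment> \<open>For fixed \<omega>, reflection and translation remove
      \<open>Z u \<omega>\<close>, leaving the constant integral of the square of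
      \<open>f\<close>.\<close>
    also have "\<dots> = (\<integral>\<^sup>+\<omega>. (\<integral>\<^sup>+x. ennreal ((f x)\<^sup>2) \<partial>lborel) \<partial>M)"
    proof (rule nn_integral_cong)
      fix \<omega>
      show "(\<integral>\<^sup>+x. ennreal (?h ((Z u \<omega>, Z u \<omega>), x)) \<partial>lborel) = (\<integral>\<^sup>+x. ennreal ((f x)\<^sup>2) \<partial>lborel)"
        by (subst nn_integral_real_affine[of "\<lambda>x. ennreal ((f x)\<^sup>2)" "-1" "Z u \<omega>"]) simp_all
    qed
    also have "\<dots> < \<infinity>"
      using sq by (simp add: emeasure_space_1 integrable_iff_bounded)
    finally show "(\<integral>\<^sup>+\<omega>. ennreal ((g u \<omega>)\<^sup>2) \<partial>M) < \<infinity>" .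
  qed (use g[OF u] in simp_all)

  note AE_eps = AE_rademacher[OF eps assms(8,9)]

  let ?Y = "dilution_field f \<pi>X \<epsilon> X Z"
  have Y: "?Y u = (\<lambda>\<omega>. \<epsilon> \<omega> * g u \<omega>)" for u
    by (simp add: fun_eq_iff dilution_field_def g_def)
  \<comment> \<open>The sign squares to 1 almost surely and so drops out of every product of two
    values.\<close>
  have YY: "AE \<omega> in M. ?Y u \<omega> * ?Y v \<omega> = g u \<omega> * g v \<omega>" for u v
    using AE_eps by eventually_elim (auto simp: Y)

  \<comment> \<open>Zero mean\<close>
  have mean: "integrable M (?Y u)" "expectation (?Y u) = 0" if u: "u \<in> points G" for u
  proof -
    have int_g: "integrable M (g u)"
      by (rule square_integrable_imp_integrable[OF g[OF u] int_gg[OF u]])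
    have "indep_var borel \<epsilon> borel (g u)"
    proof (rule indep_var_if_indep_set[OF indep_eps alg(2) _ epsB])
      show AC: "sigma_algebra (space M) ?AC"
        using sub by (intro sigma_algebra_sigma_sets) simp
      \<comment> \<open>\<open>g u\<close> depends on both \<open>Z u\<close> and \<open>X\<close>,
        so each must be seen as measurable for the joint \<sigma>-algebra \<open>?AC\<close>; the
        inclusion is proved once for both.\<close>
      have "subalgebra (sigma (space M) ?AC) (sigma (space M) \<A>)"
        if "sigma_algebra (space M) \<A>" "\<A> \<subseteq> ?A \<union> ?C" for \<A>
      proof -
        interpret AC: sigma_algebra "space M" ?AC by (rule AC)
        show ?thesis
          using subalgebra_sigma[of "sigma (space M) ?AC" \<A>] that
          by (simp add: space_measure_of_conv subset_iff)
      qed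
      then have [measurable]: "Z u \<in> borel_measurable (sigma (space M) ?AC)"
          "X \<in> borel_measurable (sigma (space M) ?AC)"
        using measurable_from_subalg[OF _ ZA[OF u]] measurable_from_subalg[OF _ XC] alg by auto
      show "g u \<in> borel_measurable (sigma (space M) ?AC)"
        unfolding g_def[abs_def] by measurable
    qed
    then show "integrable M (?Y u)" "expectation (?Y u) = 0"
      unfolding Y using rademacher_expectation[OF eps assms(8,9)] int_g
      by (simp_all add: indep_var_integrable indep_var_lebesgue_integral)
  qed

  \<comment> \<open>Covariance through the Gaussian increment\<close>
  have cov: "integrable lborel (\<lambda>z. transitive_covariogram f (sqrt (resistance_metric M Z u v) * z)
        * exp (- z\<^sup>2 / 2))"
      "covariance M (?Y u) (?Y v) = C_Y f (resistance_metric M Z u v)"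
    if u: "u \<in> points G" and v: "v \<in> points G" for u v
  proof -
    let ?h = "\<lambda>y::(real \<times> real) \<times> real. f (fst (fst y) - snd y) * f (snd (fst y) - snd y)"
    have "integrable M (\<lambda>\<omega>. g u \<omega> * g v \<omega>)"
      using u v by (intro integrable_mult_of_square int_gg g)
    then have int: "integrable M (\<lambda>\<omega>. ?h ((Z u \<omega>, Z v \<omega>), X \<omega>) / \<pi>X (X \<omega>))"
      by (simp add: g_mult)
    have h: "?h \<in> borel_measurable ((borel \<Otimes>\<^sub>M borel) \<Otimes>\<^sub>M lborel)"
      by measurable
    note fubini = pair[OF u v] dens joint[OF u v] pos h int
    \<comment> \<open>The inner integral over the sampling point is a reflected product, that is,
      the covariogram at the increment.\<close>
    have int_psi: "integrable M (\<lambda>\<omega>. transitive_covariogram f (Z u \<omega> - Z v \<omega>))"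
      using integrable_div_density[OF fubini] by (simp add: integral_reflected_product)
    have D: "(\<lambda>\<omega>. Z u \<omega> - Z v \<omega>) \<in> borel_measurable M"
      using Z[OF u] Z[OF v] by simp
    obtain \<sigma> where \<sigma>: "0 \<le> \<sigma>" "distr M borel (\<lambda>\<omega>. Z u \<omega> - Z v \<omega>) = normal_law 0 \<sigma>"
      using auxiliary_field_diff_normal[OF assms(1,2,4) u v] by blast
    \<comment> \<open>The resistance metric is by definition the variance of the increment, which
      identifies the existential \<sigma> as its square root.\<close>
    have "resistance_metric M Z u v = \<sigma>\<^sup>2"
      using variance_normal_law[OF \<sigma> D] integral_normal_law[OF \<sigma> D] by (simp add: resistance_metric_def)
    with \<sigma>(1) have root: "sqrt (resistance_metric M Z u v) = \<sigma>"
      by simp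
    show "integrable lborel (\<lambda>z. transitive_covariogram f (sqrt (resistance_metric M Z u v) * z)
        * exp (- z\<^sup>2 / 2))"
      unfolding root using int_psi by (subst (asm) integrable_normal_law_iff[OF \<sigma> D]) simp_all
    have "covariance M (?Y u) (?Y v) = expectation (\<lambda>\<omega>. ?Y u \<omega> * ?Y v \<omega>)"
      by (simp add: covariance_def mean u v)
    also have "\<dots> = expectation (\<lambda>\<omega>. g u \<omega> * g v \<omega>)"
      using YY g[OF u] g[OF v] by (intro integral_cong_AE) (simp_all add: Y)
    also have "\<dots> = expectation (\<lambda>\<omega>. transitive_covariogram f (Z u \<omega> - Z v \<omega>))"
      using integral_div_density[OF fubini] by (simp add: integral_reflected_product g_mult)
    also have "\<dots> = C_Y f (resistance_metric M Z u v)"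
      unfolding C_Y_def root by (rule integral_normal_law_eq[OF \<sigma> D]) simp
    finally show "covariance M (?Y u) (?Y v) = C_Y f (resistance_metric M Z u v)" .
  qed

  have "integrable M (\<lambda>\<omega>. (?Y u \<omega>)\<^sup>2)" if u: "u \<in> points G" for u
  proof (rule integrable_cong_AE_imp[OF int_gg[OF u]])
    show "(\<lambda>\<omega>. (?Y u \<omega>)\<^sup>2) \<in> borel_measurable M"
      using g[OF u] by (simp add: Y)
    show "AE \<omega> in M. (g u \<omega>)\<^sup>2 = (?Y u \<omega>)\<^sup>2"
      using YY[of u u] by eventually_elim (simp add: power2_eq_square)
  qed
  \<comment> \<open>Isotropy is witnessed by \<open>C_Y f\<close>.\<close>
  with mean cov show ?thesis
    using integrable_shifted_product[OF f sq] unfolding isotropic_wrt_def by blast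
qed

end
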